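(* Let $G$ be a torsion-free group with identity element $e$ and let $R$ be a $G$-graded ring. If the $G$-grading on $R$ is non-degenerate and $R_e$ is a domain, then $R$ is a prime ring.
   Context: Rings are associative, not necessarily commutative and not necessarily unital. A ring $R$ is $G$-graded if there is a collection $\{R_g\}_{g\in G}$ of additive subgroups of $R$ such that $R=\oplus_{g\in G}R_g$ and $R_gR_h\subseteq R_{gh}$ for all $g,h\in G$. The $G$-grading is non-degenerate if, for each $g\in G$ and each nonzero $r_g\in R_g$, we have $r_gR_{g^{-1}}\neq\{0\}$ and $R_{g^{-1}}r_g\neq\{0\}$. A domain is a nonzero (not necessarily commutative or unital) ring in which the product of any two nonzero elements is nonzero. A ring $R$ is prime if $I\cdot J\neq\{0\}$ for all nonzero (two-sided) ideals $I,J$ of $R$. *)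

theory Defs
  imports "HOL-Algebra.Group"
begin

text \<open>
  The grading group is a HOL-Algebra group \<open>G\<close>. The ring being graded is a type of class
  \<open>ring\<close>, which has associative multiplication and no unit; the unital locale \<open>ring\<close> of
  HOL-Algebra would be too restrictive.
\<close>

definition torsion_free_group :: "('g, 'b) monoid_scheme \<Rightarrow> bool" where
  "torsion_free_group G \<longleftrightarrow>
     (\<forall>x\<in>carrier G. \<forall>n::nat. 0 < n \<and> x [^]\<^bsub>G\<^esub> n = \<one>\<^bsub>G\<^esub> \<longrightarrow> x = \<one>\<^bsub>G\<^esub>)"

definition add_subgroup :: "'r::ring set \<Rightarrow> bool" where
  "add_subgroup A \<longleftrightarrow> 0 \<in> A \<and> (\<forall>x\<in>A. \<forall>y\<in>A. x + y \<in> A) \<and> (\<forall>x\<in>A. - x \<in> A)"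

text \<open>The product of two subsets of a ring is the set of finite sums of products of elements.\<close>

definition prod_of_sets :: "'r::ring set \<Rightarrow> 'r set \<Rightarrow> 'r set" where
  "prod_of_sets A B =
     {\<Sum>i<n. a i * b i | (n::nat) a b. (\<forall>i<n. a i \<in> A) \<and> (\<forall>i<n. b i \<in> B)}"

definition two_sided_ideal :: "'r::ring set \<Rightarrow> bool" where
  "two_sided_ideal I \<longleftrightarrow> add_subgroup I \<and> (\<forall>x\<in>I. \<forall>r. r * x \<in> I \<and> x * r \<in> I)"

definition prime_ring :: "'r::ring itself \<Rightarrow> bool" where
  "prime_ring (_ :: 'r itself) \<longleftrightarrow>
     (\<forall>I J :: 'r set. two_sided_ideal I \<and> I \<noteq> {0} \<and> two_sided_ideal J \<and> J \<noteq> {0} \<longrightarrow>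
        prod_of_sets I J \<noteq> {0})"

text \<open>A subset of a ring that is a domain under the inherited operations.\<close>

definition subring_domain :: "'r::ring set \<Rightarrow> bool" where
  "subring_domain A \<longleftrightarrow>
     add_subgroup A \<and> (\<forall>x\<in>A. \<forall>y\<in>A. x * y \<in> A) \<and>
     A \<noteq> {0} \<and> (\<forall>x\<in>A. \<forall>y\<in>A. x \<noteq> 0 \<and> y \<noteq> 0 \<longrightarrow> x * y \<noteq> 0)"

text \<open>
  The ring is the internal direct sum of the family \<open>R\<close> over \<open>carrier G\<close>. The components are
  required to vanish outside \<open>carrier G\<close> so that they are unique as a function on the whole type.
\<close>

definition internal_direct_sum :: "'g set \<Rightarrow> ('g \<Rightarrow> 'r::ring set) \<Rightarrow> bool" where
  "internal_direct_sum C R \<longleftrightarrow>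
     (\<forall>x. \<exists>!f. (\<forall>g\<in>C. f g \<in> R g) \<and> (\<forall>g. g \<notin> C \<longrightarrow> f g = 0) \<and>
               finite {g. f g \<noteq> 0} \<and> x = (\<Sum>g\<in>{g. f g \<noteq> 0}. f g))"

definition group_grading :: "('g, 'b) monoid_scheme \<Rightarrow> ('g \<Rightarrow> 'r::ring set) \<Rightarrow> bool" where
  "group_grading G R \<longleftrightarrow>
     (\<forall>g\<in>carrier G. add_subgroup (R g)) \<and>
     internal_direct_sum (carrier G) R \<and>
     (\<forall>g\<in>carrier G. \<forall>h\<in>carrier G. prod_of_sets (R g) (R h) \<subseteq> R (g \<otimes>\<^bsub>G\<^esub> h))"

definition nondegenerate_grading :: "('g, 'b) monoid_scheme \<Rightarrow> ('g \<Rightarrow> 'r::ring set) \<Rightarrow> bool" where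
  "nondegenerate_grading G R \<longleftrightarrow>
     (\<forall>g\<in>carrier G. \<forall>r\<in>R g. r \<noteq> 0 \<longrightarrow>
        prod_of_sets {r} (R (inv\<^bsub>G\<^esub> g)) \<noteq> {0} \<and> prod_of_sets (R (inv\<^bsub>G\<^esub> g)) {r} \<noteq> {0})"

end

theory Submission
  imports Defs "HOL-Algebra.Coset" "HOL-Algebra.FiniteProduct"
begin

text \<open>
  The product of two nonzero homogeneous elements is nonzero: multiplying such a product \<open>r s\<close> by
  suitable elements on both sides produces, by non-degeneracy, a product of two nonzero elements
  of the domain \<open>R\<^sub>e\<close>. In particular the degrees \<open>g\<close> with \<open>R\<^sub>g \<noteq> 0\<close> form a subgroup, the support.

  Primeness follows once \<open>a s b \<noteq> 0\<close> has a solution \<open>s\<close> for all nonzero \<open>a\<close> and \<open>b\<close>. Let \<open>S\<close> and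
  \<open>T\<close> be the sets of degrees of the nonzero components of \<open>a\<close> and \<open>b\<close>. If \<open>x\<close> is such that some
  element \<open>g\<^sub>0 x h\<^sub>0\<close> of \<open>S x T\<close> has only one representation, then for \<open>0 \<noteq> s \<in> R\<^sub>x\<close> the
  component of \<open>a s b\<close> of degree \<open>g\<^sub>0 x h\<^sub>0\<close> is the single product of the components of \<open>a\<close>, \<open>s\<close>,
  \<open>b\<close> of degrees \<open>g\<^sub>0\<close>, \<open>x\<close>, \<open>h\<^sub>0\<close>, which is nonzero. So everything reduces to a statement about
  groups, \<open>twisted_unique_product\<close>: in a torsion-free group such an \<open>x\<close> exists for all finite
  nonempty \<open>S\<close> and \<open>T\<close>. It is applied inside the support, so that \<open>R\<^sub>x \<noteq> 0\<close>.

  Torsion-free groups need not have unique products, but the freedom in \<open>x\<close> makes up for this.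
  After a translation both sets contain the identity. Let \<open>\<Delta>\<close> be the FC-centre, the set of elements
  whose centralizer has finite index. Finitely many elements of \<open>\<Delta>\<close> lie in the centralizer of a
  subgroup of finite index; that centralizer is a torsion-free group with a central subgroup of
  finite index, hence abelian by the transfer homomorphism
  (\<open>central_finite_index_imp_comm_group\<close>), and torsion-free abelian groups do have unique products
  (\<open>unique_product\<close>). Thus \<open>(S \<inter> \<Delta>) (T \<inter> \<Delta>)\<close> has a unique product \<open>g\<^sub>0 h\<^sub>0\<close>. Let \<open>x\<close> range over
  the centralizer \<open>H\<close> of \<open>S \<inter> \<Delta>\<close>, of finite index. An equation \<open>g x h = g\<^sub>0 x h\<^sub>0\<close> with \<open>g \<notin> \<Delta>\<close>
  confines \<open>x\<close> to one coset of the centralizer of \<open>g\<close>, which has infinite index. By B. H. Neumann's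
  covering lemma (\<open>covering_by_cosets_finite_index\<close>) the finitely many cosets that arise do not
  cover \<open>H\<close>, so some \<open>x\<close> avoids them all. For this \<open>x\<close> only \<open>g \<in> \<Delta>\<close> remains; then \<open>x\<close> commutes
  with \<open>g\<close> and \<open>g\<^sub>0\<close>, and the equation becomes \<open>g h = g\<^sub>0 h\<^sub>0\<close>.
\<close>

section \<open>Centralizers and subgroups of finite index\<close>

definition (in group) centralizer :: "'a set \<Rightarrow> 'a set" where
  "centralizer S = {x \<in> carrier G. \<forall>g\<in>S. x \<otimes> g = g \<otimes> x}"

lemma (in group) subgroup_centralizer:
  assumes "S \<subseteq> carrier G"
  shows "subgroup (centralizer S) G"
proof (rule subgroupI)
  show "centralizer S \<subseteq> carrier G" by (auto simp: centralizer_def)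
  have "\<one> \<in> centralizer S" using assms by (auto simp: centralizer_def)
  then show "centralizer S \<noteq> {}" by blast
next
  fix a assume a: "a \<in> centralizer S"
  then have ac: "a \<in> carrier G" by (simp add: centralizer_def)
  have "inv a \<otimes> g = g \<otimes> inv a" if "g \<in> S" for g
  proof -
    have g: "g \<in> carrier G" using that assms by blast
    have "inv a \<otimes> (g \<otimes> a) \<otimes> inv a = inv a \<otimes> (a \<otimes> g) \<otimes> inv a"
      using a that by (simp add: centralizer_def)
    then show ?thesis using ac g by (simp add: m_assoc inv_solve_left')
  qed
  then show "inv a \<in> centralizer S" using ac by (simp add: centralizer_def)
next
  fix a b assume ab: "a \<in> centralizer S" "b \<in> centralizer S"
  have "a \<otimes> b \<otimes> g = g \<otimes> (a \<otimes> b)" if "g \<in> S" for g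
  proof -
    have g: "g \<in> carrier G" using that assms by blast
    have "a \<otimes> b \<otimes> g = a \<otimes> (b \<otimes> g)" using ab g by (simp add: centralizer_def m_assoc)
    also have "\<dots> = a \<otimes> (g \<otimes> b)" using ab that by (simp add: centralizer_def)
    also have "\<dots> = (a \<otimes> g) \<otimes> b" using ab g m_assoc[symmetric] unfolding centralizer_def by blast
    also have "\<dots> = (g \<otimes> a) \<otimes> b" using ab that by (simp add: centralizer_def)
    also have "\<dots> = g \<otimes> (a \<otimes> b)" using ab g by (simp add: centralizer_def m_assoc)
    finally show ?thesis .
  qed
  then show "a \<otimes> b \<in> centralizer S" using ab by (simp add: centralizer_def)
qed

lemma (in group) rcoset_eq_iff:
  assumes "subgroup H G" "x \<in> carrier G" "y \<in> carrier G"
  shows "H #> x = H #> y \<longleftrightarrow> x \<otimes> inv y \<in> H"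
  by (metis assms repr_independence repr_independenceD subgroup.rcos_module group_axioms)

lemma (in group) finite_index_mono:
  assumes H: "subgroup H G" and K: "subgroup K G" and "H \<subseteq> K" and fin: "finite (rcosets H)"
  shows "finite (rcosets K)"
proof -
  have "rcosets K \<subseteq> (\<lambda>c. K <#> c) ` (rcosets H)"
  proof
    fix c assume "c \<in> rcosets K"
    then obtain x where x: "x \<in> carrier G" and c: "c = K #> x" by (auto simp: RCOSETS_def)
    have "K <#> (H #> x) = (K <#> H) #> x"
      using x subgroup.subset[OF H] subgroup.subset[OF K] by (simp add: setmult_rcos_assoc)
    also have "K <#> H = K"
    proof
      show "K <#> H \<subseteq> K" using K \<open>H \<subseteq> K\<close> by (auto simp: set_mult_def subgroup.m_closed)
      have "k = k \<otimes> \<one>" if "k \<in> K" for k using subgroup.mem_carrier[OF K that] by simp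
      then show "K \<subseteq> K <#> H" using subgroup.one_closed[OF H] unfolding set_mult_def by blast
    qed
    finally show "c \<in> (\<lambda>c. K <#> c) ` (rcosets H)" using x c by (auto simp: RCOSETS_def)
  qed
  then show ?thesis using fin finite_surj by blast
qed

lemma (in group) finite_index_Int:
  assumes H: "subgroup H G" and K: "subgroup K G"
    and fin: "finite (rcosets H)" "finite (rcosets K)"
  shows "finite (rcosets (H \<inter> K))"
proof -
  have HK: "subgroup (H \<inter> K) G" using H K by (rule subgroups_Inter_pair)
  have "rcosets (H \<inter> K) \<subseteq> (\<lambda>(c, d). c \<inter> d) ` ((rcosets H) \<times> (rcosets K))"
  proof
    fix c assume "c \<in> rcosets (H \<inter> K)"
    then obtain x where x: "x \<in> carrier G" and c: "c = (H \<inter> K) #> x"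
      by (auto simp: RCOSETS_def)
    have "(H \<inter> K) #> x = (H #> x) \<inter> (K #> x)"
    proof
      show "(H #> x) \<inter> (K #> x) \<subseteq> (H \<inter> K) #> x"
        using H K x by (auto simp: r_coset_def dest!: subgroup.mem_carrier)
    qed (auto simp: r_coset_def)
    then show "c \<in> (\<lambda>(c, d). c \<inter> d) ` ((rcosets H) \<times> (rcosets K))"
      using x c by (force simp: RCOSETS_def)
  qed
  then show ?thesis using fin by (meson finite_SigmaI finite_imageI finite_subset)
qed

text \<open>
  An element lies here exactly if its conjugacy class is finite.
\<close>

definition (in group) fc_centre :: "'a set" where
  "fc_centre = {g \<in> carrier G. finite (rcosets (centralizer {g}))}"

lemma (in group) finite_index_centralizer:
  assumes "finite S" "S \<subseteq> fc_centre"
  shows "finite (rcosets (centralizer S))"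
  using assms
proof (induction S)
  case empty
  have c: "centralizer {} = carrier G" by (auto simp: centralizer_def)
  have "rcosets (carrier G) \<subseteq> {carrier G}"
    by (auto simp: RCOSETS_def coset_join2 subgroup_self)
  then show ?case unfolding c by (rule finite_subset) simp
next
  case (insert g S)
  have "centralizer (insert g S) = centralizer {g} \<inter> centralizer S"
    by (auto simp: centralizer_def)
  then show ?case
    using insert by (auto intro!: finite_index_Int subgroup_centralizer simp: fc_centre_def)
qed

text \<open>
  B. H. Neumann's lemma. A subgroup can be removed from the covering: if its listed cosets \<open>H f\<close> do
  not already exhaust the group, they miss a whole coset \<open>H y\<close>, which is then covered by cosets of
  the other subgroups. As \<open>H f = H y (y\<inverse> f)\<close>, translates of those cosets cover each \<open>H f\<close> too, so
  finitely many cosets of the other subgroups cover the group.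
\<close>

lemma (in group) covering_by_cosets_finite_index:
  assumes "finite \<S>" "\<And>H. H \<in> \<S> \<Longrightarrow> subgroup H G"
    and "\<And>H. H \<in> \<S> \<Longrightarrow> finite (F H) \<and> F H \<subseteq> carrier G"
    and "carrier G \<subseteq> (\<Union>H\<in>\<S>. \<Union>f\<in>F H. H #> f)"
  shows "\<exists>H\<in>\<S>. finite (rcosets H)"
  using assms
proof (induction \<S> arbitrary: F)
  case empty
  then show ?case using one_closed by auto
next
  case (insert H \<S>)
  have H: "subgroup H G" and FH: "finite (F H)" "F H \<subseteq> carrier G"
    using insert.prems by auto
  show ?case
  proof (cases "carrier G \<subseteq> (\<Union>f\<in>F H. H #> f)")
    case True
    have "rcosets H \<subseteq> (\<lambda>f. H #> f) ` F H"
    proof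
      fix c assume "c \<in> rcosets H"
      then obtain x where x: "x \<in> carrier G" "c = H #> x" by (auto simp: RCOSETS_def)
      then obtain f where "f \<in> F H" "x \<in> H #> f" using True by blast
      then show "c \<in> (\<lambda>f. H #> f) ` F H" using x H FH repr_independence[of x H f] by auto
    qed
    then show ?thesis using FH finite_surj by blast
  next
    case False
    then obtain y where y: "y \<in> carrier G" "\<And>f. f \<in> F H \<Longrightarrow> y \<notin> H #> f" by blast
    define F' where "F' K = F K \<union> (\<lambda>(k, f). k \<otimes> inv y \<otimes> f) ` (F K \<times> F H)" for K
    have cov: "carrier G \<subseteq> (\<Union>K\<in>\<S>. \<Union>f\<in>F' K. K #> f)"
    proof
      fix x assume x: "x \<in> carrier G"
      then obtain K f where K: "K \<in> insert H \<S>" "f \<in> F K" "x \<in> K #> f"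
        using insert.prems(3) by blast
      show "x \<in> (\<Union>K\<in>\<S>. \<Union>f\<in>F' K. K #> f)"
      proof (cases "K \<in> \<S>")
        case True
        then show ?thesis using K by (auto simp: F'_def)
      next
        case False
        then have KH: "K = H" using K by blast
        have f: "f \<in> carrier G" using K KH FH by blast
        obtain h where h: "h \<in> H" "x = h \<otimes> f" using K KH by (auto simp: r_coset_def)
        have hc: "h \<in> carrier G" using subgroup.mem_carrier[OF H h(1)] .
        \<comment> \<open>The coset \<open>H y\<close> avoids all \<open>H f\<close>, so \<open>h y\<close> lies in a coset of another subgroup.\<close>
        have hy: "h \<otimes> y \<in> carrier G" using hc y by simp
        then obtain L k where L: "L \<in> insert H \<S>" "k \<in> F L" "h \<otimes> y \<in> L #> k"
          using insert.prems(3) by blast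
        have "L \<noteq> H"
        proof
          assume "L = H"
          then have "H #> k = H #> (h \<otimes> y)" using L FH by (intro repr_independence H) auto
          also have "\<dots> = H #> y"
            using h hc y H by (simp add: rcoset_eq_iff m_assoc)
          finally have "y \<in> H #> k" using repr_independenceD[OF H y(1)] by simp
          then show False using y L \<open>L = H\<close> by blast
        qed
        then have LS: "L \<in> \<S>" using L by blast
        then have L': "subgroup L G" "k \<in> carrier G" using insert.prems L by blast+
        obtain l where l: "l \<in> L" "h \<otimes> y = l \<otimes> k" using L by (auto simp: r_coset_def)
        have lc: "l \<in> carrier G" using subgroup.mem_carrier[OF L'(1) l(1)] .
        have "x = (h \<otimes> y) \<otimes> inv y \<otimes> f" using h hc y f by (simp add: m_assoc)
        also have "\<dots> = l \<otimes> (k \<otimes> inv y \<otimes> f)" using l lc L' y f by (simp add: m_assoc)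
        finally have "x \<in> L #> (k \<otimes> inv y \<otimes> f)" using l by (auto simp: r_coset_def)
        moreover have "k \<otimes> inv y \<otimes> f \<in> F' L" using L K KH by (force simp: F'_def)
        ultimately show ?thesis using LS by blast
      qed
    qed
    have "finite (F' K) \<and> F' K \<subseteq> carrier G" if "K \<in> \<S>" for K
    proof -
      have "finite (F K)" "F K \<subseteq> carrier G" using insert.prems that by blast+
      then show ?thesis using FH y by (auto simp: F'_def subset_iff)
    qed
    then have "\<exists>K\<in>\<S>. finite (rcosets K)"
      using insert.IH[of F'] insert.prems(1) cov by blast
    then show ?thesis by blast
  qed
qed

section \<open>Torsion-free groups with a central subgroup of finite index\<close>

text \<open>
  The transfer homomorphism \<open>V\<close> into the central subgroup \<open>Z\<close> restricts to \<open>z \<mapsto> z\<^sup>n\<close> on \<open>Z\<close>, where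
  \<open>n\<close> is the index. Every element has a positive power in \<open>Z\<close>, so in a torsion-free group \<open>V\<close> has
  trivial kernel. Since \<open>Z\<close> is abelian, commutators lie in the kernel.
\<close>

lemma (in group) central_finite_index_imp_comm_group:
  assumes tf: "torsion_free_group G" and Z: "subgroup Z G"
    and central: "\<And>z g. z \<in> Z \<Longrightarrow> g \<in> carrier G \<Longrightarrow> z \<otimes> g = g \<otimes> z"
    and fin: "finite (rcosets Z)"
  shows "comm_group G"
proof -
  let ?Q = "rcosets Z" and ?Z = "G\<lparr>carrier := Z\<rparr>"
  have Zc: "\<And>z. z \<in> Z \<Longrightarrow> z \<in> carrier G" by (rule subgroup.mem_carrier[OF Z])
  interpret Z: comm_group ?Z
    using subgroup_imp_group[OF Z] central Zc by (intro group.group_comm_groupI) auto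
  define rep where "rep c = (SOME x. x \<in> c)" for c :: "'a set"
  have rep: "rep c \<in> carrier G" "Z #> rep c = c" if "c \<in> ?Q" for c
  proof -
    have "c \<noteq> {}" using subgroup.rcosets_non_empty[OF Z that] .
    then have r: "rep c \<in> c" unfolding rep_def using some_in_eq by blast
    obtain x where x: "x \<in> carrier G" "c = Z #> x" using \<open>c \<in> ?Q\<close> by (auto simp: RCOSETS_def)
    show "rep c \<in> carrier G" using r x Z group_axioms subgroup.elemrcos_carrier by metis
    show "Z #> rep c = c" using r x Z repr_independence by metis
  qed
  have act: "c #> g \<in> ?Q" if "c \<in> ?Q" "g \<in> carrier G" for c g
  proof -
    have "c #> g = Z #> (rep c \<otimes> g)"
      using rep[OF that(1)] that(2) Z by (metis coset_mult_assoc subgroup.subset)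
    then show ?thesis using rep[OF that(1)] that(2) Z by (simp add: rcosetsI subgroup.subset)
  qed
  have Qc: "c \<subseteq> carrier G" if "c \<in> ?Q" for c
    using that Z group_axioms subgroup.rcosets_carrier by blast
  \<comment> \<open>Right multiplication by \<open>g\<close> sends the representative of \<open>c\<close> to that of \<open>c g\<close> up to this
    factor; \<open>V g\<close> is the product of the factors over all cosets.\<close>
  define \<tau> where "\<tau> g c = rep c \<otimes> g \<otimes> inv (rep (c #> g))" for g c
  have \<tau>: "\<tau> g c \<in> Z" if "c \<in> ?Q" "g \<in> carrier G" for g c
  proof -
    have "Z #> (rep c \<otimes> g) = Z #> rep (c #> g)"
      using rep[OF that(1)] rep[OF act[OF that]] that Z by (metis coset_mult_assoc subgroup.subset)
    then show ?thesis unfolding \<tau>_def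
      using rcoset_eq_iff[OF Z] rep(1)[OF that(1)] rep(1)[OF act[OF that]] that(2) by simp
  qed
  define V where "V g = finprod ?Z (\<tau> g) ?Q" for g
  have VZ: "V g \<in> Z" if "g \<in> carrier G" for g
    using Z.finprod_closed[of "\<tau> g" ?Q] \<tau> that by (auto simp: V_def)
  have V_mult: "V (g \<otimes> h) = V g \<otimes> V h" if g: "g \<in> carrier G" and h: "h \<in> carrier G" for g h
  proof -
    have cocycle: "\<tau> (g \<otimes> h) c = \<tau> g c \<otimes> \<tau> h (c #> g)" if c: "c \<in> ?Q" for c
    proof -
      have "c #> (g \<otimes> h) = c #> g #> h" using Qc[OF c] g h by (simp add: coset_mult_assoc)
      then show ?thesis
        using rep(1)[OF c] rep(1)[OF act[OF c g]] rep(1)[OF act[OF act[OF c g] h]] g h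
        by (simp add: \<tau>_def m_assoc inv_solve_left)
    qed
    have inj: "inj_on (\<lambda>c. c #> g) ?Q"
    proof (rule inj_onI)
      fix c d assume cd: "c \<in> ?Q" "d \<in> ?Q" "c #> g = d #> g"
      have "c #> g #> inv g = c" if "c \<in> ?Q" for c
        using Qc[OF that] g by (simp add: coset_mult_assoc)
      then show "c = d" using cd by metis
    qed
    have im: "(\<lambda>c. c #> g) ` ?Q = ?Q"
      using endo_inj_surj[OF fin _ inj] act g by blast
    have "V (g \<otimes> h) = finprod ?Z (\<lambda>c. \<tau> g c \<otimes>\<^bsub>?Z\<^esub> \<tau> h (c #> g)) ?Q"
      unfolding V_def using \<tau> act g h cocycle subgroup.m_closed[OF Z]
      by (intro Z.finprod_cong') auto
    also have "\<dots> = V g \<otimes> finprod ?Z (\<lambda>c. \<tau> h (c #> g)) ?Q"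
      unfolding V_def using \<tau> act g h by (subst Z.finprod_multf) auto
    also have "finprod ?Z (\<lambda>c. \<tau> h (c #> g)) ?Q = finprod ?Z (\<tau> h) ((\<lambda>c. c #> g) ` ?Q)"
      using \<tau> act g h inj im by (intro Z.finprod_reindex[symmetric]) auto
    finally show ?thesis by (simp add: im V_def)
  qed
  have V_central: "V z = z [^] card ?Q" if z: "z \<in> Z" for z
  proof -
    have "\<tau> z c = z" if c: "c \<in> ?Q" for c
    proof -
      have "c #> z = Z #> (z \<otimes> rep c)"
        using rep[OF c] z Zc Z central by (metis coset_mult_assoc subgroup.subset)
      also have "\<dots> = c"
        using rep[OF c] z Zc Z by (metis coset_mult_assoc subgroup.subset coset_join2)
      finally show ?thesis
        using rep[OF c] z Zc central by (simp add: \<tau>_def m_assoc flip: central)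
    qed
    then have "V z = finprod ?Z (\<lambda>c. z) ?Q"
      unfolding V_def using z by (intro Z.finprod_cong') auto
    also have "\<dots> = z [^] card ?Q" using Z.finprod_const[of z] z by (simp flip: nat_pow_consistent)
    finally show ?thesis .
  qed
  have V_ker: "x = \<one>" if x: "x \<in> carrier G" and Vx: "V x = \<one>" for x
  proof -
    \<comment> \<open>Two powers of \<open>x\<close> lie in the same coset, so a positive power of \<open>x\<close> lies in \<open>Z\<close>.\<close>
    have "\<not> inj_on (\<lambda>i::nat. Z #> x [^] i) UNIV"
    proof
      assume "inj_on (\<lambda>i::nat. Z #> x [^] i) UNIV"
      moreover have "range (\<lambda>i::nat. Z #> x [^] i) \<subseteq> ?Q"
        using x Z by (auto intro!: rcosetsI subgroup.subset)
      ultimately show False using fin finite_subset finite_imageD infinite_UNIV_nat by metis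
    qed
    then obtain i j :: nat where "i < j" and ij: "Z #> x [^] i = Z #> x [^] j"
      unfolding inj_on_def by (metis linorder_neqE_nat)
    define m where "m = j - i"
    have m: "m > 0" "j = m + i" using \<open>i < j\<close> by (auto simp: m_def)
    have "x [^] j \<otimes> inv (x [^] i) \<in> Z"
      using ij x Z by (simp flip: rcoset_eq_iff)
    then have xm: "x [^] m \<in> Z"
      using x by (simp add: m(2) nat_pow_mult[symmetric] m_assoc)
    have "V \<one> \<otimes> V \<one> = V \<one> \<otimes> \<one>" using V_mult[of \<one> \<one>] VZ[of \<one>] Zc by simp
    then have V1: "V \<one> = \<one>" using VZ[of \<one>] Zc by (metis l_cancel_one one_closed r_one)
    have "V (x [^] k) = \<one>" for k :: nat
      by (induction k) (use V1 V_mult x Vx in auto)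
    then have "(x [^] m) [^] card ?Q = \<one>" using V_central[OF xm] by simp
    then have "x [^] (m * card ?Q) = \<one>" using x by (simp add: nat_pow_pow)
    moreover have "card ?Q > 0" using fin rcosetsI[of Z \<one>] Z subgroup.subset card_gt_0_iff by blast
    ultimately show ?thesis
      using tf x m unfolding torsion_free_group_def by (meson nat_0_less_mult_iff)
  qed
  show ?thesis
  proof (rule group_comm_groupI)
    fix x y assume x: "x \<in> carrier G" and y: "y \<in> carrier G"
    let ?c = "x \<otimes> y \<otimes> inv (y \<otimes> x)"
    have c: "?c \<in> carrier G" using x y by simp
    have yx: "y \<otimes> x \<in> carrier G" using x y by simp
    have cyx: "?c \<otimes> (y \<otimes> x) = x \<otimes> y" using x y by (simp add: m_assoc del: inv_mult_group)
    have "V ?c \<otimes> V (y \<otimes> x) = V (x \<otimes> y)" using V_mult[OF c yx] unfolding cyx by simp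
    also have "\<dots> = V (y \<otimes> x)" using x y V_mult VZ central Zc by simp
    finally have "V ?c = \<one>" using VZ[OF c] VZ[OF yx] Zc by (metis r_cancel_one)
    then have "?c = \<one>" using V_ker c by blast
    then show "x \<otimes> y = y \<otimes> x" using cyx yx by (metis l_one)
  qed
qed

text \<open>
  The intersection of \<open>H\<close> with its centralizer is central in the centralizer and has finite index
  there.
\<close>

lemma (in group) comm_group_centralizer_of_finite_index:
  assumes tf: "torsion_free_group G" and H: "subgroup H G" and fin: "finite (rcosets H)"
  shows "comm_group (G\<lparr>carrier := centralizer H\<rparr>)"
proof -
  let ?K = "centralizer H"
  have K: "subgroup ?K G" using H by (simp add: subgroup_centralizer subgroup.subset)
  interpret K: group "G\<lparr>carrier := ?K\<rparr>" using K by (rule subgroup_imp_group)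
  show ?thesis
  proof (rule K.central_finite_index_imp_comm_group)
    show "torsion_free_group (G\<lparr>carrier := ?K\<rparr>)"
      using tf by (auto simp: torsion_free_group_def centralizer_def simp flip: nat_pow_consistent)
    show "subgroup (H \<inter> ?K) (G\<lparr>carrier := ?K\<rparr>)"
      using H K by (simp add: subgroup_incl subgroups_Inter_pair)
    show "finite (rcosets\<^bsub>G\<lparr>carrier := ?K\<rparr>\<^esub> (H \<inter> ?K))"
    proof -
      have "rcosets\<^bsub>G\<lparr>carrier := ?K\<rparr>\<^esub> (H \<inter> ?K) \<subseteq> (\<lambda>c. c \<inter> ?K) ` (rcosets H)"
      proof
        fix c assume "c \<in> rcosets\<^bsub>G\<lparr>carrier := ?K\<rparr>\<^esub> (H \<inter> ?K)"
        then obtain x where x: "x \<in> ?K" "c = (H \<inter> ?K) #> x" by (auto simp: RCOSETS_def)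
        have xc: "x \<in> carrier G" using subgroup.mem_carrier[OF K x(1)] .
        have "(H \<inter> ?K) #> x = (H #> x) \<inter> ?K"
        proof
          show "(H \<inter> ?K) #> x \<subseteq> (H #> x) \<inter> ?K"
            using x K by (auto simp: r_coset_def subgroup.m_closed)
          show "(H #> x) \<inter> ?K \<subseteq> (H \<inter> ?K) #> x"
          proof
            fix y assume "y \<in> (H #> x) \<inter> ?K"
            then obtain h where h: "h \<in> H" "y = h \<otimes> x" "y \<in> ?K" by (auto simp: r_coset_def)
            have "h = y \<otimes> inv x" using h(2) xc subgroup.mem_carrier[OF H h(1)] by (simp add: m_assoc)
            moreover have "y \<otimes> inv x \<in> ?K"
              using h(3) x K by (simp add: subgroup.m_closed subgroup.m_inv_closed)
            ultimately have "h \<in> ?K" by simp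
            then show "y \<in> (H \<inter> ?K) #> x" using h by (auto simp: r_coset_def)
          qed
        qed
        then show "c \<in> (\<lambda>c. c \<inter> ?K) ` (rcosets H)" using x xc by (auto simp: RCOSETS_def)
      qed
      then show ?thesis using fin finite_surj by blast
    qed
  qed (auto simp: centralizer_def)
qed

section \<open>Unique products in torsion-free abelian groups\<close>

text \<open>
  Pointed submonoids are the cones of nonnegative elements of partial orders compatible with the
  multiplication, where \<open>x \<le> y\<close> means \<open>x\<inverse> y \<in> M\<close>. The second condition is antisymmetry: \<open>M\<close> has
  no units except the identity.
\<close>

definition (in monoid) pointed :: "'a set \<Rightarrow> bool" where
  "pointed M \<longleftrightarrow> submonoid M G \<and> (\<forall>x\<in>M. \<forall>y\<in>M. x \<otimes> y = \<one> \<longrightarrow> x = \<one>)"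

text \<open>
  The submonoid generated by \<open>M\<close> and \<open>d\<close> can fail to be pointed only through a relation
  \<open>m d\<^sup>n = 1\<close> with \<open>m \<in> M\<close> and \<open>n > 0\<close>, and for the inverse of \<open>d\<close> only through \<open>m' = d\<^sup>k\<close> with
  \<open>m' \<in> M\<close> and \<open>k > 0\<close>. Both together give \<open>m\<^sup>k m'\<^sup>n = 1\<close>, so \<open>m\<^sup>k = 1\<close> and \<open>m = 1\<close>, whence \<open>d\<close> is
  a torsion element. Thus one of the two signs is possible.
\<close>

lemma (in comm_group) pointed_adjoin:
  assumes tf: "torsion_free_group G" and M: "pointed M" and d: "d \<in> carrier G"
  shows "\<exists>M'. pointed M' \<and> M \<subseteq> M' \<and> (d \<in> M' \<or> inv d \<in> M')"
proof -
  have Ms: "submonoid M G" using M by (simp add: pointed_def)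
  have Mc: "\<And>m. m \<in> M \<Longrightarrow> m \<in> carrier G" by (rule submonoid.mem_carrier[OF Ms])
  define N where "N e = {m \<otimes> e [^] n | m n. m \<in> M \<and> n \<in> (UNIV :: nat set)}" for e
  have N_mult: "(m \<otimes> e [^] n) \<otimes> (m' \<otimes> e [^] n') = (m \<otimes> m') \<otimes> e [^] (n + n')"
    if "e \<in> carrier G" "m \<in> M" "m' \<in> M" for e m m' and n n' :: nat
    using that Mc by (simp add: nat_pow_mult[symmetric] m_ac)
  have N_sub: "submonoid (N e) G" if e: "e \<in> carrier G" for e
  proof
    show "N e \<subseteq> carrier G" using e Mc by (auto simp: N_def)
    have "\<one> = \<one> \<otimes> e [^] (0::nat)" by simp
    then show "\<one> \<in> N e" using submonoid.one_closed[OF Ms] unfolding N_def by blast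
    fix x y assume "x \<in> N e" "y \<in> N e"
    then obtain m n m' n' where "m \<in> M" "m' \<in> M" "x = m \<otimes> e [^] (n::nat)" "y = m' \<otimes> e [^] (n'::nat)"
      unfolding N_def by blast
    then have "x \<otimes> y = (m \<otimes> m') \<otimes> e [^] (n + n')" "m \<otimes> m' \<in> M"
      using N_mult[OF e] submonoid.m_closed[OF Ms] by simp_all
    then show "x \<otimes> y \<in> N e" unfolding N_def by blast
  qed
  have M_N: "M \<subseteq> N e" if "e \<in> carrier G" for e
  proof
    fix m assume "m \<in> M"
    then have "m = m \<otimes> e [^] (0::nat)" using Mc by simp
    then show "m \<in> N e" using \<open>m \<in> M\<close> unfolding N_def by blast
  qed
  have e_N: "e \<in> N e" if "e \<in> carrier G" for e
  proof -
    have "e = \<one> \<otimes> e [^] (1::nat)" using that by simp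
    then show ?thesis using submonoid.one_closed[OF Ms] unfolding N_def by blast
  qed
  have obstruction: "\<exists>m\<in>M. \<exists>n::nat. 0 < n \<and> m \<otimes> e [^] n = \<one>"
    if e: "e \<in> carrier G" and np: "\<not> pointed (N e)" for e
  proof -
    obtain x y where xy: "x \<in> N e" "y \<in> N e" "x \<otimes> y = \<one>" "x \<noteq> \<one>"
      using np N_sub[OF e] unfolding pointed_def by blast
    then obtain m n m' n' where m: "m \<in> M" "m' \<in> M"
      and x: "x = m \<otimes> e [^] (n::nat)" and y: "y = m' \<otimes> e [^] (n'::nat)"
      unfolding N_def by blast
    have eq: "(m \<otimes> m') \<otimes> e [^] (n + n') = \<one>" using xy(3) N_mult[OF e m] x y by simp
    have "n + n' \<noteq> 0"
    proof
      assume 0: "n + n' = 0"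
      then have "m \<otimes> m' = \<one>" using eq m Mc by simp
      then have "m = \<one>" using M m unfolding pointed_def by blast
      then show False using xy(4) x 0 by simp
    qed
    then show ?thesis using eq submonoid.m_closed[OF Ms m] by blast
  qed
  show ?thesis
  proof (cases "pointed (N d) \<or> pointed (N (inv d))")
    case True
    then show ?thesis using M_N e_N d by blast
  next
    case False
    obtain m and n :: nat where m: "m \<in> M" "0 < n" "m \<otimes> d [^] n = \<one>"
      using obstruction[OF d] False by blast
    obtain m' and k :: nat where m': "m' \<in> M" "0 < k" "m' \<otimes> inv d [^] k = \<one>"
      using obstruction[of "inv d"] d False by blast
    have "inv (d [^] k) = inv d [^] k" using d by (simp add: nat_pow_inv)
    then have "m' \<otimes> inv (d [^] k) = \<one>" using m'(3) by simp
    moreover have "m' = m' \<otimes> inv (d [^] k) \<otimes> d [^] k" using Mc[OF m'(1)] d by (simp add: m_assoc)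
    ultimately have m'd: "m' = d [^] k" using d by simp
    have pow: "x [^] j \<in> M" if "x \<in> M" for x and j :: nat
      by (induction j) (use that submonoid.one_closed[OF Ms] submonoid.m_closed[OF Ms] in auto)
    have "m [^] k \<otimes> m' [^] n = (m \<otimes> d [^] n) [^] k"
      using Mc[OF m(1)] d by (simp add: m'd nat_pow_distrib nat_pow_pow mult.commute)
    then have "m [^] k \<otimes> m' [^] n = \<one>" using m by simp
    then have "m [^] k = \<one>" using M pow[OF m(1)] pow[OF m'(1)] unfolding pointed_def by blast
    then have "m = \<one>" using tf m'(2) Mc[OF m(1)] unfolding torsion_free_group_def by blast
    then have "d [^] n = \<one>" using m(3) d by simp
    then have "d = \<one>" using tf m(2) d unfolding torsion_free_group_def by blast
    then show ?thesis using M submonoid.one_closed[OF Ms] by blast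
  qed
qed

lemma (in comm_group) pointed_for_finite_set:
  assumes tf: "torsion_free_group G" and "finite D" "D \<subseteq> carrier G"
  shows "\<exists>M. pointed M \<and> (\<forall>d\<in>D. d \<in> M \<or> inv d \<in> M)"
  using assms(2,3)
proof (induction D)
  case empty
  have "submonoid {\<one>} G" by standard auto
  then have "pointed {\<one>}" by (simp add: pointed_def)
  then show ?case by blast
next
  case (insert d D)
  then obtain M where M: "pointed M" "\<forall>d\<in>D. d \<in> M \<or> inv d \<in> M" by auto
  obtain M' where "pointed M'" "M \<subseteq> M'" "d \<in> M' \<or> inv d \<in> M'"
    using pointed_adjoin[OF tf M(1)] insert.prems by blast
  then show ?case using M(2) by blast
qed

text \<open>
  For an order that is total on \<open>S\<close> and on \<open>T\<close>, the product of the two greatest elements has only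
  one representation. Such an order arises by deciding the signs of the finitely many quotients of
  elements of \<open>S \<union> T\<close>.
\<close>

lemma (in comm_group) unique_product:
  assumes tf: "torsion_free_group G"
    and S: "finite S" "S \<noteq> {}" "S \<subseteq> carrier G" and T: "finite T" "T \<noteq> {}" "T \<subseteq> carrier G"
  shows "\<exists>g\<^sub>0\<in>S. \<exists>h\<^sub>0\<in>T. \<forall>g\<in>S. \<forall>h\<in>T. g \<otimes> h = g\<^sub>0 \<otimes> h\<^sub>0 \<longrightarrow> g = g\<^sub>0 \<and> h = h\<^sub>0"
proof -
  let ?D = "(\<lambda>(x, y). inv x \<otimes> y) ` ((S \<union> T) \<times> (S \<union> T))"
  have ST: "S \<union> T \<subseteq> carrier G" using S T by blast
  have "?D \<subseteq> carrier G"
  proof (rule image_subsetI)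
    fix p assume "p \<in> (S \<union> T) \<times> (S \<union> T)"
    then obtain x y where "p = (x, y)" "x \<in> carrier G" "y \<in> carrier G" using ST by blast
    then show "(\<lambda>(x, y). inv x \<otimes> y) p \<in> carrier G" by simp
  qed
  moreover have "finite ?D" using S T by simp
  ultimately obtain M where M: "pointed M" and MD: "\<forall>d\<in>?D. d \<in> M \<or> inv d \<in> M"
    using pointed_for_finite_set[OF tf, of ?D] by blast
  have Ms: "submonoid M G" using M by (simp add: pointed_def)
  have total: "inv x \<otimes> y \<in> M \<or> inv y \<otimes> x \<in> M" if "x \<in> S \<union> T" "y \<in> S \<union> T" for x y
  proof -
    have c: "x \<in> carrier G" "y \<in> carrier G" using that ST by auto
    have "inv x \<otimes> y \<in> ?D" using that by (intro rev_image_eqI[of "(x, y)"]) simp_all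
    moreover have "inv (inv x \<otimes> y) = inv y \<otimes> x" using c by (simp add: inv_mult_group)
    ultimately show ?thesis using MD by metis
  qed
  have greatest: "\<exists>m\<in>U. \<forall>x\<in>U. inv x \<otimes> m \<in> M"
    if "finite U" "U \<noteq> {}" "U \<subseteq> S \<union> T" for U
    using that
  proof (induction U rule: finite_ne_induct)
    case (singleton u)
    then have "u \<in> carrier G" using S T by blast
    then show ?case using submonoid.one_closed[OF Ms] by simp
  next
    case (insert u U)
    then obtain m where m: "m \<in> U" "\<forall>x\<in>U. inv x \<otimes> m \<in> M" by auto
    have c: "u \<in> carrier G" "m \<in> carrier G" "U \<subseteq> carrier G"
      using insert.prems m(1) ST by auto
    have um: "u \<in> S \<union> T" "m \<in> S \<union> T" using insert.prems m(1) by auto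
    from total[OF um] show ?case
    proof
      assume "inv u \<otimes> m \<in> M"
      then show ?thesis using m by blast
    next
      assume mu: "inv m \<otimes> u \<in> M"
      have "inv x \<otimes> u \<in> M" if "x \<in> U" for x
      proof -
        have x: "x \<in> carrier G" using that c by blast
        have "m \<otimes> (inv m \<otimes> u) = u" using c by (simp flip: m_assoc)
        then have "inv x \<otimes> u = (inv x \<otimes> m) \<otimes> (inv m \<otimes> u)" using x c by (simp add: m_assoc)
        then show ?thesis using submonoid.m_closed[OF Ms] m(2) that mu by simp
      qed
      then show ?thesis using submonoid.one_closed[OF Ms] c by auto
    qed
  qed
  obtain g\<^sub>0 where g0: "g\<^sub>0 \<in> S" "\<forall>g\<in>S. inv g \<otimes> g\<^sub>0 \<in> M" using greatest[of S] S by blast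
  obtain h\<^sub>0 where h0: "h\<^sub>0 \<in> T" "\<forall>h\<in>T. inv h \<otimes> h\<^sub>0 \<in> M" using greatest[of T] T by blast
  have "g = g\<^sub>0 \<and> h = h\<^sub>0" if g: "g \<in> S" and h: "h \<in> T" and eq: "g \<otimes> h = g\<^sub>0 \<otimes> h\<^sub>0" for g h
  proof -
    have c: "g \<in> carrier G" "h \<in> carrier G" "g\<^sub>0 \<in> carrier G" "h\<^sub>0 \<in> carrier G"
      using g h g0(1) h0(1) S(3) T(3) by auto
    have "(inv g \<otimes> g\<^sub>0) \<otimes> (inv h \<otimes> h\<^sub>0) = inv (g \<otimes> h) \<otimes> (g\<^sub>0 \<otimes> h\<^sub>0)"
      using c by (simp add: inv_mult m_ac)
    also have "\<dots> = \<one>" unfolding eq using c by simp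
    finally have "(inv g \<otimes> g\<^sub>0) \<otimes> (inv h \<otimes> h\<^sub>0) = \<one>" .
    moreover have "inv g \<otimes> g\<^sub>0 \<in> M" "inv h \<otimes> h\<^sub>0 \<in> M" using g0(2) h0(2) g h by auto
    ultimately have 1: "inv g \<otimes> g\<^sub>0 = \<one>" using M unfolding pointed_def by blast
    have "g\<^sub>0 = g \<otimes> (inv g \<otimes> g\<^sub>0)" using c by (simp flip: m_assoc)
    then have "g = g\<^sub>0" using c by (simp add: 1)
    then show ?thesis using eq c by simp
  qed
  then show ?thesis using g0(1) h0(1) by blast
qed

section \<open>Twisted unique products in torsion-free groups\<close>

text \<open>
  In particular products and inverses of elements of the FC-centre belong to it, since the double
  centralizer of \<open>S\<close> is a subgroup that contains \<open>S\<close>.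
\<close>

lemma (in group) fc_centre_double_centralizer:
  assumes S: "finite S" "S \<subseteq> fc_centre" and y: "y \<in> centralizer (centralizer S)"
  shows "y \<in> fc_centre"
proof -
  have Sc: "S \<subseteq> carrier G" using S by (auto simp: fc_centre_def)
  have yc: "y \<in> carrier G" using y by (simp add: centralizer_def)
  have "finite (rcosets (centralizer S))"
    using S by (rule finite_index_centralizer)
  moreover have "centralizer S \<subseteq> centralizer {y}" using y by (auto simp: centralizer_def)
  ultimately have "finite (rcosets (centralizer {y}))"
    using finite_index_mono[OF subgroup_centralizer[OF Sc] subgroup_centralizer] yc by simp
  then show ?thesis using yc by (simp add: fc_centre_def)
qed

text \<open>
  Both sets lie in the double centralizer of their union, an abelian group.
\<close>

lemma (in group) unique_product_fc_centre:
  assumes tf: "torsion_free_group G"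
    and S: "finite S" "S \<noteq> {}" "S \<subseteq> fc_centre" and T: "finite T" "T \<noteq> {}" "T \<subseteq> fc_centre"
  shows "\<exists>g\<^sub>0\<in>S. \<exists>h\<^sub>0\<in>T. \<forall>g\<in>S. \<forall>h\<in>T. g \<otimes> h = g\<^sub>0 \<otimes> h\<^sub>0 \<longrightarrow> g = g\<^sub>0 \<and> h = h\<^sub>0"
proof -
  let ?H = "centralizer (S \<union> T)"
  let ?K = "centralizer ?H"
  have ST: "S \<union> T \<subseteq> carrier G" using S T by (auto simp: fc_centre_def)
  have H: "subgroup ?H G" using ST by (rule subgroup_centralizer)
  have "finite (rcosets ?H)"
    using S T by (intro finite_index_centralizer) auto
  then interpret K: comm_group "G\<lparr>carrier := ?K\<rparr>"
    using comm_group_centralizer_of_finite_index[OF tf H] by blast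
  have "S \<union> T \<subseteq> ?K" using ST by (auto simp: centralizer_def)
  moreover have "torsion_free_group (G\<lparr>carrier := ?K\<rparr>)"
    using tf by (auto simp: torsion_free_group_def centralizer_def simp flip: nat_pow_consistent)
  ultimately show ?thesis using K.unique_product[of S T] S T by simp
qed

text \<open>
  The solutions \<open>x\<close> of \<open>g x = x k\<close> form a single coset of the centralizer of \<open>g\<close>, if there are any.
  If such cosets covered \<open>H\<close>, finitely many translates of them would cover the whole group, and some
  \<open>g\<close> would lie in the FC-centre by the covering lemma.
\<close>

lemma (in group) exists_avoiding_conjugations:
  assumes H: "subgroup H G" "finite (rcosets H)"
    and fin: "finite E" and E: "E \<subseteq> (carrier G - fc_centre) \<times> carrier G"
  shows "\<exists>x\<in>H. \<forall>(g, k)\<in>E. g \<otimes> x \<noteq> x \<otimes> k"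
proof (rule ccontr)
  assume no: "\<not> ?thesis"
  have cov: "\<exists>(g, k)\<in>E. g \<otimes> x = x \<otimes> k" if "x \<in> H" for x using no that by blast
  have Hc: "\<And>x. x \<in> H \<Longrightarrow> x \<in> carrier G" by (rule subgroup.mem_carrier[OF H(1)])
  define rep where "rep p = (SOME x. x \<in> H \<and> fst p \<otimes> x = x \<otimes> snd p)" for p
  have rep: "rep (g, k) \<in> H \<and> g \<otimes> rep (g, k) = rep (g, k) \<otimes> k"
    if "x \<in> H" "g \<otimes> x = x \<otimes> k" for g k x
    unfolding rep_def fst_conv snd_conv
    by (rule someI[of "\<lambda>x. x \<in> H \<and> g \<otimes> x = x \<otimes> k"]) (use that in simp)
  obtain t where t: "finite t" "t \<subseteq> carrier G" "carrier G \<subseteq> (\<Union>f\<in>t. H #> f)"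
  proof -
    obtain t where t: "t \<subseteq> carrier G" "finite t" "rcosets H = (\<lambda>f. H #> f) ` t"
    proof -
      have "rcosets H \<subseteq> (\<lambda>f. H #> f) ` carrier G" by (auto simp: RCOSETS_def)
      then show ?thesis using finite_subset_image[OF H(2)] that by metis
    qed
    have "carrier G \<subseteq> (\<Union>f\<in>t. H #> f)"
    proof
      fix x assume x: "x \<in> carrier G"
      then have "H #> x \<in> (\<lambda>f. H #> f) ` t" using t(3) by (auto simp: RCOSETS_def)
      then show "x \<in> (\<Union>f\<in>t. H #> f)" using rcos_self[OF x H(1)] by auto
    qed
    then show ?thesis using t that by blast
  qed
  define R where "R = rep ` E \<inter> H"
  have R: "finite R" "R \<subseteq> carrier G" using fin Hc by (auto simp: R_def)
  define F where "F = (\<lambda>(r, f). r \<otimes> f) ` (R \<times> t)"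
  have F: "finite F" "F \<subseteq> carrier G" using R t by (auto simp: F_def)
  have "\<exists>C\<in>(\<lambda>(g, k). centralizer {g}) ` E. finite (rcosets C)"
  proof (rule covering_by_cosets_finite_index)
    show "carrier G \<subseteq> (\<Union>C\<in>(\<lambda>(g, k). centralizer {g}) ` E. \<Union>f\<in>F. C #> f)"
    proof
      fix y assume "y \<in> carrier G"
      then obtain f x where f: "f \<in> t" and x: "x \<in> H" and y: "y = x \<otimes> f"
        using t(3) by (auto simp: r_coset_def)
      obtain g k where gk: "(g, k) \<in> E" "g \<otimes> x = x \<otimes> k" using cov[OF x] by blast
      let ?r = "rep (g, k)"
      have r: "?r \<in> H" "g \<otimes> ?r = ?r \<otimes> k" using rep[OF x gk(2)] by auto
      have c: "g \<in> carrier G" "x \<in> carrier G" "?r \<in> carrier G" "f \<in> carrier G"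
        using E gk(1) Hc x r(1) f t(2) by auto
      have k: "k \<in> carrier G" using E gk(1) by blast
      have rR: "?r \<in> R" using gk(1) r(1) by (auto simp: R_def)
      have cent: "x \<otimes> inv ?r \<in> centralizer {g}"
      proof -
        have "inv ?r \<otimes> g = k \<otimes> inv ?r"
          using c k r(2) by (simp add: inv_solve_right m_assoc inv_solve_left)
        then have "(x \<otimes> inv ?r) \<otimes> g = x \<otimes> (k \<otimes> inv ?r)" using c by (simp add: m_assoc)
        also have "\<dots> = (g \<otimes> x) \<otimes> inv ?r" unfolding gk(2) using c k by (simp add: m_assoc)
        finally show ?thesis using c by (simp add: centralizer_def m_assoc)
      qed
      have "y = (x \<otimes> inv ?r) \<otimes> (?r \<otimes> f)" using c y by (simp add: m_assoc inv_solve_left)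
      then have "y \<in> centralizer {g} #> (?r \<otimes> f)" using cent by (auto simp: r_coset_def)
      moreover have "?r \<otimes> f \<in> F" using rR f by (auto simp: F_def)
      ultimately show "y \<in> (\<Union>C\<in>(\<lambda>(g, k). centralizer {g}) ` E. \<Union>f\<in>F. C #> f)"
        using gk(1) by force
    qed
  next
    show "subgroup C G" if "C \<in> (\<lambda>(g, k). centralizer {g}) ` E" for C
      using that E by (auto intro!: subgroup_centralizer)
  qed (use fin F in auto)
  then show False using E by (force simp: fc_centre_def)
qed

lemma (in group) twisted_unique_product:
  assumes tf: "torsion_free_group G"
    and S: "finite S" "S \<noteq> {}" "S \<subseteq> carrier G" and T: "finite T" "T \<noteq> {}" "T \<subseteq> carrier G"
  shows "\<exists>x\<in>carrier G. \<exists>g\<^sub>0\<in>S. \<exists>h\<^sub>0\<in>T. \<forall>g\<in>S. \<forall>h\<in>T.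
           g \<otimes> x \<otimes> h = g\<^sub>0 \<otimes> x \<otimes> h\<^sub>0 \<longrightarrow> g = g\<^sub>0 \<and> h = h\<^sub>0"
proof -
  obtain s t where s: "s \<in> S" "s \<in> carrier G" and t: "t \<in> T" "t \<in> carrier G" using S T by blast
  let ?S = "(\<lambda>g. inv s \<otimes> g) ` S" and ?T = "(\<lambda>h. h \<otimes> inv t) ` T"
  \<comment> \<open>After translation both sets contain the identity, so they meet the FC-centre.\<close>
  let ?A = "?S \<inter> fc_centre" and ?B = "?T \<inter> fc_centre"
  have "centralizer {\<one>} = carrier G" by (auto simp: centralizer_def)
  moreover have "centralizer {} = carrier G" by (auto simp: centralizer_def)
  ultimately have one: "\<one> \<in> fc_centre"
    using finite_index_centralizer[of "{}"] by (simp add: fc_centre_def)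
  have "\<one> \<in> ?S" using s by (intro rev_image_eqI[OF s(1)]) simp
  moreover have "\<one> \<in> ?T" using t by (intro rev_image_eqI[OF t(1)]) simp
  ultimately have ne: "?A \<noteq> {}" "?B \<noteq> {}" using one by blast+
  obtain g\<^sub>1 h\<^sub>1 where g1: "g\<^sub>1 \<in> ?A" and h1: "h\<^sub>1 \<in> ?B"
    and uniq: "\<And>g h. g \<in> ?A \<Longrightarrow> h \<in> ?B \<Longrightarrow> g \<otimes> h = g\<^sub>1 \<otimes> h\<^sub>1 \<Longrightarrow> g = g\<^sub>1 \<and> h = h\<^sub>1"
    using unique_product_fc_centre[OF tf, of ?A ?B] S T ne by blast
  have Sc: "?S \<subseteq> carrier G" and Tc: "?T \<subseteq> carrier G" using s t S T by auto
  let ?H = "centralizer ?A"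
  have "?A \<subseteq> carrier G" using Sc by blast
  then have H: "subgroup ?H G" "finite (rcosets ?H)"
    using S by (auto intro!: subgroup_centralizer finite_index_centralizer)
  \<comment> \<open>The equation \<open>g x h = x g\<^sub>1 h\<^sub>1\<close>, solved for \<open>g x\<close>.\<close>
  let ?E = "(\<lambda>(g, h). (g, g\<^sub>1 \<otimes> h\<^sub>1 \<otimes> inv h)) ` ((?S - fc_centre) \<times> ?T)"
  have g1c: "g\<^sub>1 \<in> carrier G" and h1c: "h\<^sub>1 \<in> carrier G" using g1 h1 Sc Tc by blast+
  have E: "finite ?E" using S T by simp
  have "?E \<subseteq> (carrier G - fc_centre) \<times> carrier G"
  proof (rule image_subsetI)
    fix p assume "p \<in> (?S - fc_centre) \<times> ?T"
    then obtain g h where "p = (g, h)" "g \<in> carrier G - fc_centre" "h \<in> carrier G" using Sc Tc by blast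
    then show "(\<lambda>(g, h). (g, g\<^sub>1 \<otimes> h\<^sub>1 \<otimes> inv h)) p \<in> (carrier G - fc_centre) \<times> carrier G"
      using g1c h1c by simp
  qed
  then obtain x where x: "x \<in> ?H" and avoid: "\<forall>(g, k)\<in>?E. g \<otimes> x \<noteq> x \<otimes> k"
    using exists_avoiding_conjugations[OF H E] by blast
  have xc: "x \<in> carrier G" using subgroup.mem_carrier[OF H(1) x] .
  have core: "g = g\<^sub>1 \<and> h = h\<^sub>1"
    if g: "g \<in> ?S" and h: "h \<in> ?T" and eq: "g \<otimes> x \<otimes> h = g\<^sub>1 \<otimes> x \<otimes> h\<^sub>1" for g h
  proof -
    have gc: "g \<in> carrier G" and hc: "h \<in> carrier G" using g h Sc Tc by blast+
    have "g\<^sub>1 \<otimes> x = x \<otimes> g\<^sub>1" using x g1 by (simp add: centralizer_def)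
    then have eq': "g \<otimes> x \<otimes> h = x \<otimes> (g\<^sub>1 \<otimes> h\<^sub>1)" using eq xc g1c h1c by (simp add: m_assoc)
    have "g \<otimes> x = g \<otimes> x \<otimes> h \<otimes> inv h" using gc hc xc by (simp add: m_assoc)
    then have gx: "g \<otimes> x = x \<otimes> (g\<^sub>1 \<otimes> h\<^sub>1 \<otimes> inv h)"
      unfolding eq' using hc xc g1c h1c by (simp add: m_assoc)
    have g_fc: "g \<in> fc_centre"
    proof (rule ccontr)
      assume "g \<notin> fc_centre"
      then have "(g, g\<^sub>1 \<otimes> h\<^sub>1 \<otimes> inv h) \<in> ?E"
        using g h by (intro rev_image_eqI[of "(g, h)"]) simp_all
      then show False using avoid gx by blast
    qed
    then have "g \<otimes> x = x \<otimes> g" using x g by (simp add: centralizer_def)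
    then have "x \<otimes> (g \<otimes> h) = x \<otimes> (g\<^sub>1 \<otimes> h\<^sub>1)" using eq' gc hc xc by (simp add: m_assoc)
    then have gh: "g \<otimes> h = g\<^sub>1 \<otimes> h\<^sub>1" using gc hc xc g1c h1c by simp
    have "h \<in> fc_centre"
    proof (rule fc_centre_double_centralizer)
      let ?U = "{g, g\<^sub>1, h\<^sub>1}"
      show "finite ?U" "?U \<subseteq> fc_centre" using g_fc g1 h1 by auto
      let ?K = "centralizer (centralizer ?U)"
      have K: "subgroup ?K G" by (rule subgroup_centralizer) (auto simp: centralizer_def)
      have U: "?U \<subseteq> ?K" using gc g1c h1c by (auto simp: centralizer_def)
      have "h = inv g \<otimes> (g\<^sub>1 \<otimes> h\<^sub>1)" using gh gc hc g1c h1c by (simp add: inv_solve_left)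
      then show "h \<in> ?K" using U subgroup.m_closed[OF K] subgroup.m_inv_closed[OF K] by simp
    qed
    then show ?thesis using uniq g h g_fc gh by blast
  qed
  have g0: "s \<otimes> g\<^sub>1 \<in> S" and h0: "h\<^sub>1 \<otimes> t \<in> T"
    using g1 h1 s t S T by (auto simp: m_assoc subset_iff simp flip: m_assoc[of s])
  have "g = s \<otimes> g\<^sub>1 \<and> h = h\<^sub>1 \<otimes> t"
    if g: "g \<in> S" and h: "h \<in> T" and eq: "g \<otimes> x \<otimes> h = s \<otimes> g\<^sub>1 \<otimes> x \<otimes> (h\<^sub>1 \<otimes> t)" for g h
  proof -
    have gc: "g \<in> carrier G" and hc: "h \<in> carrier G" using g h S T by blast+
    have "(inv s \<otimes> g) \<otimes> x \<otimes> (h \<otimes> inv t) = inv s \<otimes> (g \<otimes> x \<otimes> h) \<otimes> inv t"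
      using gc hc xc s t by (simp add: m_assoc)
    also have "g \<otimes> x \<otimes> h = s \<otimes> (g\<^sub>1 \<otimes> x \<otimes> h\<^sub>1) \<otimes> t"
      unfolding eq using g1c h1c xc s t by (simp add: m_assoc)
    also have "inv s \<otimes> (s \<otimes> (g\<^sub>1 \<otimes> x \<otimes> h\<^sub>1) \<otimes> t) \<otimes> inv t = g\<^sub>1 \<otimes> x \<otimes> h\<^sub>1 \<otimes> t \<otimes> inv t"
      using g1c h1c xc s t by (simp flip: m_assoc)
    also have "\<dots> = g\<^sub>1 \<otimes> x \<otimes> h\<^sub>1" using g1c h1c xc s t by (simp add: m_assoc)
    finally have "inv s \<otimes> g = g\<^sub>1 \<and> h \<otimes> inv t = h\<^sub>1" using core g h by blast
    then show ?thesis using gc hc s t by (auto simp: m_assoc simp flip: m_assoc[of s])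
  qed
  then show ?thesis using xc g0 h0 by blast
qed

section \<open>Direct sums of additive subgroups\<close>

lemma mult_mem_prod_of_sets:
  assumes "x \<in> A" "y \<in> B"
  shows "x * y \<in> prod_of_sets A B"
  using assms unfolding prod_of_sets_def
  by (intro CollectI exI[of _ "1::nat"] exI[of _ "\<lambda>_. x"] exI[of _ "\<lambda>_. y"]) auto

lemma prod_of_sets_nonzeroE:
  assumes "prod_of_sets A B \<noteq> {0}"
  obtains x y where "x \<in> A" "y \<in> B" "x * y \<noteq> (0 :: 'r::ring)"
proof (rule ccontr)
  assume no: "\<not> thesis"
  have zero: "\<forall>x\<in>A. \<forall>y\<in>B. x * y = 0" using no that by blast
  have "0 \<in> prod_of_sets A B"
    unfolding prod_of_sets_def by (intro CollectI exI[of _ "0::nat"]) auto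
  moreover have "prod_of_sets A B \<subseteq> {0}"
    unfolding prod_of_sets_def using zero by (auto intro!: sum.neutral)
  ultimately show False using assms by blast
qed

lemma add_subgroup_sum:
  assumes "add_subgroup A" "\<And>i. i \<in> I \<Longrightarrow> f i \<in> A"
  shows "sum f I \<in> A"
  using assms(2)
  by (induction I rule: infinite_finite_induct) (use assms(1) in \<open>auto simp: add_subgroup_def\<close>)

lemma internal_direct_sum_eq_0:
  assumes ds: "internal_direct_sum C R" and C: "\<And>g. g \<in> C \<Longrightarrow> 0 \<in> R g"
    and K: "finite K" "K \<subseteq> C" and f: "\<And>k. k \<in> K \<Longrightarrow> f k \<in> R k"
    and sum0: "(\<Sum>k\<in>K. f k) = 0" and k: "k \<in> K"
  shows "f k = 0"
proof -
  define f' where "f' g = (if g \<in> K then f g else 0)" for g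
  define P where "P f \<longleftrightarrow> (\<forall>g\<in>C. f g \<in> R g) \<and> (\<forall>g. g \<notin> C \<longrightarrow> f g = 0) \<and>
    finite {g. f g \<noteq> 0} \<and> 0 = (\<Sum>g\<in>{g. f g \<noteq> 0}. f g)" for f
  have sub: "{g. f' g \<noteq> 0} \<subseteq> K" by (auto simp: f'_def)
  have "(\<Sum>g\<in>{g. f' g \<noteq> 0}. f' g) = (\<Sum>g\<in>K. f' g)"
    using K sub by (intro sum.mono_neutral_left) auto
  also have "\<dots> = 0" using sum0 by (simp add: f'_def)
  finally have "P f'"
    using K C f sub finite_subset by (auto simp: P_def f'_def)
  moreover have "P (\<lambda>_. 0)" using C by (simp add: P_def)
  moreover have "\<exists>!f. P f" using ds unfolding internal_direct_sum_def P_def by (rule spec)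
  ultimately have "f' = (\<lambda>_. 0)" by blast
  then show ?thesis using k by (metis f'_def)
qed

section \<open>Graded rings with a domain in degree the identity\<close>

locale domain_graded_ring = group G
  for G :: "('g, 'b) monoid_scheme" (structure) and R :: "'g \<Rightarrow> 'r::ring set" +
  assumes grading: "group_grading G R"
    and nondegenerate: "nondegenerate_grading G R"
    and domain: "subring_domain (R \<one>)"
begin

lemma add_subgroup_component: "g \<in> carrier G \<Longrightarrow> add_subgroup (R g)"
  using grading by (simp add: group_grading_def)

lemma zero_mem_component: "g \<in> carrier G \<Longrightarrow> 0 \<in> R g"
  using add_subgroup_component by (simp add: add_subgroup_def)

lemma mult_mem_component:
  assumes "g \<in> carrier G" "h \<in> carrier G" "r \<in> R g" "s \<in> R h"
  shows "r * s \<in> R (g \<otimes> h)"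
  using grading assms mult_mem_prod_of_sets unfolding group_grading_def by blast

text \<open>
  By non-degeneracy \<open>r' r\<close> and \<open>s s'\<close> are nonzero elements of the domain \<open>R\<^sub>e\<close> for suitable \<open>r'\<close> and
  \<open>s'\<close>, so \<open>r' (r s) s' \<noteq> 0\<close>.
\<close>

lemma homogeneous_mult_nonzero:
  assumes g: "g \<in> carrier G" "r \<in> R g" "r \<noteq> 0" and h: "h \<in> carrier G" "s \<in> R h" "s \<noteq> 0"
  shows "r * s \<noteq> 0"
proof
  assume rs: "r * s = 0"
  have "prod_of_sets (R (inv g)) {r} \<noteq> {0}" "prod_of_sets {s} (R (inv h)) \<noteq> {0}"
    using nondegenerate g h unfolding nondegenerate_grading_def by blast+
  then obtain r' s' where r': "r' \<in> R (inv g)" "r' * r \<noteq> 0" and s': "s' \<in> R (inv h)" "s * s' \<noteq> 0"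
    by (metis prod_of_sets_nonzeroE singletonD)
  have "r' * r \<in> R \<one>" "s * s' \<in> R \<one>"
    using mult_mem_component[of "inv g" g r' r] mult_mem_component[of h "inv h" s s'] r' s' g h
    by simp_all
  then have "(r' * r) * (s * s') \<noteq> 0"
    using domain r' s' unfolding subring_domain_def by blast
  moreover have "(r' * r) * (s * s') = r' * (r * s) * s'" by (simp add: mult.assoc)
  ultimately show False using rs by simp
qed

definition support :: "'g set" where
  "support = {g \<in> carrier G. R g \<noteq> {0}}"

lemma supportE:
  assumes "g \<in> support"
  obtains r where "r \<in> R g" "r \<noteq> 0"
  using assms zero_mem_component unfolding support_def by blast

lemma supportI: "g \<in> carrier G \<Longrightarrow> r \<in> R g \<Longrightarrow> r \<noteq> 0 \<Longrightarrow> g \<in> support"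
  unfolding support_def by blast

lemma subgroup_support: "subgroup support G"
proof
  show "support \<subseteq> carrier G" by (auto simp: support_def)
  show "\<one> \<in> support" using domain by (simp add: support_def subring_domain_def)
next
  fix g h assume gh: "g \<in> support" "h \<in> support"
  then have c: "g \<in> carrier G" "h \<in> carrier G" by (auto simp: support_def)
  obtain r s where "r \<in> R g" "r \<noteq> 0" "s \<in> R h" "s \<noteq> 0" using gh by (meson supportE)
  then show "g \<otimes> h \<in> support"
    using c mult_mem_component homogeneous_mult_nonzero supportI m_closed by metis
next
  fix g assume g: "g \<in> support"
  then have c: "g \<in> carrier G" by (auto simp: support_def)
  obtain r where r: "r \<in> R g" "r \<noteq> 0" using g by (rule supportE)
  then have "prod_of_sets {r} (R (inv g)) \<noteq> {0}"
    using nondegenerate c unfolding nondegenerate_grading_def by blast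
  then obtain s where s: "s \<in> R (inv g)" "r * s \<noteq> 0" by (metis prod_of_sets_nonzeroE singletonD)
  then have "s \<noteq> 0" by auto
  then show "inv g \<in> support" using s c supportI inv_closed by blast
qed

lemma nonzero_decomposition:
  assumes "a \<noteq> (0::'r)"
  obtains S f where "finite S" "S \<noteq> {}" "S \<subseteq> carrier G"
    "\<And>g. g \<in> S \<Longrightarrow> f g \<in> R g" "\<And>g. g \<in> S \<Longrightarrow> f g \<noteq> 0" "a = (\<Sum>g\<in>S. f g)"
proof -
  obtain f where f: "\<forall>g\<in>carrier G. f g \<in> R g" "\<forall>g. g \<notin> carrier G \<longrightarrow> f g = 0"
    "finite {g. f g \<noteq> 0}" "a = (\<Sum>g\<in>{g. f g \<noteq> 0}. f g)"
    using grading unfolding group_grading_def internal_direct_sum_def by metis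
  show ?thesis
  proof (rule that[of "{g. f g \<noteq> 0}" f])
    show "{g. f g \<noteq> 0} \<noteq> {}" using f(4) assms by (metis sum.empty)
  qed (use f in auto)
qed

text \<open>
  The degree \<open>x\<close> of \<open>s\<close> is chosen such that some component of \<open>a s b\<close> consists of a single product
  of nonzero homogeneous elements.
\<close>

lemma exists_sandwich_nonzero:
  assumes tf: "torsion_free_group G" and a: "a \<noteq> (0::'r)" and b: "b \<noteq> (0::'r)"
  shows "\<exists>s. a * s * b \<noteq> 0"
proof -
  obtain S f where S: "finite S" "S \<noteq> {}" "S \<subseteq> carrier G"
    and f: "\<And>g. g \<in> S \<Longrightarrow> f g \<in> R g" "\<And>g. g \<in> S \<Longrightarrow> f g \<noteq> 0" and a_eq: "a = (\<Sum>g\<in>S. f g)"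
    using nonzero_decomposition[OF a] by blast
  obtain T k where T: "finite T" "T \<noteq> {}" "T \<subseteq> carrier G"
    and k: "\<And>h. h \<in> T \<Longrightarrow> k h \<in> R h" "\<And>h. h \<in> T \<Longrightarrow> k h \<noteq> 0" and b_eq: "b = (\<Sum>h\<in>T. k h)"
    using nonzero_decomposition[OF b] by blast
  have sub: "S \<subseteq> support" "T \<subseteq> support"
    using supportI[OF subsetD[OF S(3)] f] supportI[OF subsetD[OF T(3)] k] by auto
  interpret P: group "G\<lparr>carrier := support\<rparr>" using subgroup_support by (rule subgroup_imp_group)
  have "torsion_free_group (G\<lparr>carrier := support\<rparr>)"
    using tf by (auto simp: torsion_free_group_def support_def simp flip: nat_pow_consistent)
  then have "\<exists>x\<in>support. \<exists>g\<^sub>0\<in>S. \<exists>h\<^sub>0\<in>T. \<forall>g\<in>S. \<forall>h\<in>T.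
      g \<otimes> x \<otimes> h = g\<^sub>0 \<otimes> x \<otimes> h\<^sub>0 \<longrightarrow> g = g\<^sub>0 \<and> h = h\<^sub>0"
    using P.twisted_unique_product[of S T] S T sub by simp
  then obtain x g\<^sub>0 h\<^sub>0 where x: "x \<in> support" and g0: "g\<^sub>0 \<in> S" and h0: "h\<^sub>0 \<in> T"
    and uniq: "\<And>g h. g \<in> S \<Longrightarrow> h \<in> T \<Longrightarrow> g \<otimes> x \<otimes> h = g\<^sub>0 \<otimes> x \<otimes> h\<^sub>0 \<Longrightarrow> g = g\<^sub>0 \<and> h = h\<^sub>0"
    by blast
  obtain s where s: "s \<in> R x" "s \<noteq> 0" using x by (rule supportE)
  have xc: "x \<in> carrier G" using x by (simp add: support_def)
  define d where "d = (\<lambda>(g, h). g \<otimes> x \<otimes> h)"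
  define q where "q = (\<lambda>(g, h). f g * s * k h)"
  define c where "c y = sum q {p \<in> S \<times> T. d p = y}" for y
  let ?y = "g\<^sub>0 \<otimes> x \<otimes> h\<^sub>0"
  have q: "q p \<in> R (d p)" "d p \<in> carrier G" if "p \<in> S \<times> T" for p
  proof -
    obtain g h where p: "p = (g, h)" "g \<in> S" "h \<in> T" using \<open>p \<in> S \<times> T\<close> by blast
    then have c: "g \<in> carrier G" "h \<in> carrier G" using S T by blast+
    then show "d p \<in> carrier G" using xc p by (simp add: d_def)
    have "f g * s \<in> R (g \<otimes> x)" using mult_mem_component[of g x] c(1) xc f(1)[OF p(2)] s(1) by simp
    then show "q p \<in> R (d p)"
      using mult_mem_component[of "g \<otimes> x" h] c xc k(1) p by (simp add: d_def q_def)
  qed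
  have "a * s = (\<Sum>g\<in>S. f g * s)" by (simp add: a_eq sum_distrib_right)
  then have "a * s * b = sum q (S \<times> T)"
    by (simp add: b_eq q_def sum_product sum.cartesian_product)
  also have "\<dots> = (\<Sum>y\<in>d ` (S \<times> T). c y)"
    unfolding c_def using S T by (intro sum.image_gen) simp
  finally have asb: "a * s * b = (\<Sum>y\<in>d ` (S \<times> T). c y)" .
  have "{p \<in> S \<times> T. d p = ?y} = {(g\<^sub>0, h\<^sub>0)}"
    using g0 h0 uniq by (auto simp: d_def)
  then have cy: "c ?y = f g\<^sub>0 * s * k h\<^sub>0" by (simp add: c_def q_def)
  have c0: "g\<^sub>0 \<in> carrier G" "h\<^sub>0 \<in> carrier G" using g0 h0 S T by blast+
  have "f g\<^sub>0 * s \<in> R (g\<^sub>0 \<otimes> x)" "f g\<^sub>0 * s \<noteq> 0"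
    using mult_mem_component[of g\<^sub>0 x] homogeneous_mult_nonzero[of g\<^sub>0 _ x] c0(1) xc f[OF g0] s
    by simp_all
  then have "c ?y \<noteq> 0"
    unfolding cy using homogeneous_mult_nonzero[of "g\<^sub>0 \<otimes> x" _ h\<^sub>0] c0 xc k h0 by simp
  moreover have "c ?y = 0" if "a * s * b = 0"
  proof (rule internal_direct_sum_eq_0[where C = "carrier G" and R = R and K = "d ` (S \<times> T)"])
    show "internal_direct_sum (carrier G) R" using grading by (simp add: group_grading_def)
    show "c y \<in> R y" if "y \<in> d ` (S \<times> T)" for y
    proof -
      have "y \<in> carrier G" using that q by blast
      then show ?thesis
        unfolding c_def using q by (intro add_subgroup_sum add_subgroup_component) auto
    qed
    show "?y \<in> d ` (S \<times> T)" using g0 h0 by (intro rev_image_eqI[of "(g\<^sub>0, h\<^sub>0)"]) (auto simp: d_def)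
    show "sum c (d ` (S \<times> T)) = 0" using that asb by simp
    show "finite (d ` (S \<times> T))" using S T by simp
    show "d ` (S \<times> T) \<subseteq> carrier G" using q by blast
  qed (rule zero_mem_component)
  ultimately show ?thesis by blast
qed

end

theorem theorem4p4:
  fixes G :: "('g, 'b) monoid_scheme"
    and R :: "'g \<Rightarrow> 'r::ring set"
  assumes "group G"
    and "torsion_free_group G"
    and "group_grading G R"
    and "nondegenerate_grading G R"
    and "subring_domain (R \<one>\<^bsub>G\<^esub>)"
  shows "prime_ring TYPE('r)"
proof -
  interpret domain_graded_ring G R
    using assms by (simp add: domain_graded_ring_def domain_graded_ring_axioms_def)
  show ?thesis
    unfolding prime_ring_def
  proof (intro allI impI)
    fix I J :: "'r set"
    assume IJ: "two_sided_ideal I \<and> I \<noteq> {0} \<and> two_sided_ideal J \<and> J \<noteq> {0}"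
    then have "0 \<in> I" "0 \<in> J" by (auto simp: two_sided_ideal_def add_subgroup_def)
    then obtain a b where a: "a \<in> I" "a \<noteq> 0" and b: "b \<in> J" "b \<noteq> 0" using IJ by blast
    obtain s where s: "a * s * b \<noteq> 0" using exists_sandwich_nonzero[OF assms(2) a(2) b(2)] ..
    have "a * s \<in> I" using IJ a(1) by (simp add: two_sided_ideal_def)
    then have "a * s * b \<in> prod_of_sets I J" using b(1) by (rule mult_mem_prod_of_sets)
    then show "prod_of_sets I J \<noteq> {0}" using s by blast
  qed
qed

end
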